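(* Let $H,H'\in\mathcal{T}_{\mathcal{H}}$ be encodings of Hydras and let $n$ be a natural number. If $\mathsf{A}(\mathsf{s}^n(\mathsf{0}),H)\to^{*}_{\mathcal{H}/\mathrm{AC}}\mathsf{A}(\mathsf{s}^{n+1}(\mathsf{0}),H')$, then $H$ and $H'$ are successive Hydras in a battle, i.e. $H'$ encodes a Hydra obtained by a battle step at stage $n$ from the Hydra encoded by $H$.
   Context: Terms are built from variables and the function symbols: constants $\mathsf{h},\mathsf{0}$; unary $\mathsf{I},\mathsf{E},\mathsf{s}$; binary $\mathsf{A},\mathsf{B},\mathsf{C},\mathsf{D}$ and binary $\mid$ written infix. $=_{\mathrm{AC}}$ is the congruence generated by associativity and commutativity of $\mid$. For a set $\mathcal{R}$ of rules, $\to_{\mathcal{R}}$ is its closure under substitutions and contexts and $\to_{\mathcal{R}/\mathrm{AC}}={=_{\mathrm{AC}}}\cdot{\to_{\mathcal{R}}}\cdot{=_{\mathrm{AC}}}$; $\to^*$ denotes the reflexive transitive closure. The TRS $\mathcal{H}$ consists of the rules: (1) $\mathsf{A}(n,\mathsf{I}(\mathsf{h}))\to\mathsf{A}(\mathsf{s}(n),\mathsf{h})$; (2) $\mathsf{A}(n,\mathsf{I}(\mathsf{h}\mid x))\to\mathsf{A}(\mathsf{s}(n),\mathsf{I}(x))$; (3) $\mathsf{A}(n,\mathsf{I}(x))\to\mathsf{B}(n,\mathsf{D}(\mathsf{s}(n),\mathsf{I}(x)))$; (4) $\mathsf{C}(\mathsf{0},x)\to\mathsf{E}(x)$; (5) $\mathsf{C}(\mathsf{s}(n),x)\to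 x\mid\mathsf{C}(n,x)$; (6) $\mathsf{I}(\mathsf{E}(x)\mid y)\to\mathsf{E}(\mathsf{I}(x\mid y))$; (7) $\mathsf{I}(\mathsf{E}(x))\to\mathsf{E}(\mathsf{I}(x))$; (8) $\mathsf{D}(n,\mathsf{I}(\mathsf{I}(x)))\to\mathsf{I}(\mathsf{D}(n,\mathsf{I}(x)))$; (9) $\mathsf{D}(n,\mathsf{I}(\mathsf{I}(x)\mid y))\to\mathsf{I}(\mathsf{D}(n,\mathsf{I}(x))\mid y)$; (10) $\mathsf{D}(n,\mathsf{I}(\mathsf{I}(\mathsf{h}\mid x)\mid y))\to\mathsf{I}(\mathsf{C}(n,\mathsf{I}(x))\mid y)$; (11) $\mathsf{D}(n,\mathsf{I}(\mathsf{I}(\mathsf{h}\mid x)))\to\mathsf{I}(\mathsf{C}(n,\mathsf{I}(x)))$; (12) $\mathsf{D}(n,\mathsf{I}(\mathsf{I}(\mathsf{h})\mid y))\to\mathsf{I}(\mathsf{C}(n,\mathsf{h})\mid y)$; (13) $\mathsf{D}(n,\mathsf{I}(\mathsf{I}(\mathsf{h})))\to\mathsf{I}(\mathsf{C}(n,\mathsf{h}))$; (14) $\mathsf{B}(n,\mathsf{E}(x))\to\mathsf{A}(\mathsf{s}(n),x)$. $\mathcal{T}_{\mathcal{H}}$ is the set of ground terms over $\{\mathsf{h},\mathsf{I},\mid\}$. A Hydra is a finite rooted unordered tree; its heads are its leaves other than the root. An encoding of a Hydra: a single node is encoded as $\mathsf{h}$, and a node whose subtrees are $T_1,\dots,T_k$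 ($k\ge1$) is encoded as $\mathsf{I}(t_1\mid\cdots\mid t_k)$ with $t_i$ an encoding of $T_i$ (unique up to $=_{\mathrm{AC}}$). A battle step at stage $n$ transforms a Hydra $T$ with at least one head into $T'$: choose any head $\ell$, with parent $p$, and delete $\ell$; if $p$ is the root, the result is $T'$; otherwise, with $g$ the parent of $p$ and $P$ the subtree rooted at $p$ after deletion, $T'$ is obtained by replacing $P$, as a child subtree of $g$, by $n+2$ copies of $P$. In a battle $T_0,T_1,\dots$, $T_{n+1}$ arises from $T_n$ by a battle step at stage $n$; $T_n,T_{n+1}$ are successive Hydras. *)

theory Defs
  imports "HOL-Library.Multiset"
begin

section \<open>Terms and rewriting modulo AC\<close>

text \<open>The function symbols are grouped by arity, so that every inhabitant of the type of terms
  respects the signature.\<close>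

datatype sym0 = Sym_h | Sym_0
datatype sym1 = Sym_I | Sym_E | Sym_s
datatype sym2 = Sym_A | Sym_B | Sym_C | Sym_D | Sym_bar

datatype trm = Var string | Fun0 sym0 | Fun1 sym1 trm | Fun2 sym2 trm trm

abbreviation tH :: trm where "tH \<equiv> Fun0 Sym_h"
abbreviation tZ :: trm where "tZ \<equiv> Fun0 Sym_0"
abbreviation tI :: "trm \<Rightarrow> trm" where "tI t \<equiv> Fun1 Sym_I t"
abbreviation tE :: "trm \<Rightarrow> trm" where "tE t \<equiv> Fun1 Sym_E t"
abbreviation tS :: "trm \<Rightarrow> trm" where "tS t \<equiv> Fun1 Sym_s t"
abbreviation tA :: "trm \<Rightarrow> trm \<Rightarrow> trm" where "tA s t \<equiv> Fun2 Sym_A s t"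
abbreviation tB :: "trm \<Rightarrow> trm \<Rightarrow> trm" where "tB s t \<equiv> Fun2 Sym_B s t"
abbreviation tC :: "trm \<Rightarrow> trm \<Rightarrow> trm" where "tC s t \<equiv> Fun2 Sym_C s t"
abbreviation tD :: "trm \<Rightarrow> trm \<Rightarrow> trm" where "tD s t \<equiv> Fun2 Sym_D s t"
abbreviation tBar :: "trm \<Rightarrow> trm \<Rightarrow> trm"  (infixr "\<parallel>" 65) where "s \<parallel> t \<equiv> Fun2 Sym_bar s t"

type_synonym trs = "(trm \<times> trm) set"

primrec subst :: "(string \<Rightarrow> trm) \<Rightarrow> trm \<Rightarrow> trm" where
  "subst \<sigma> (Var v) = \<sigma> v"
| "subst \<sigma> (Fun0 c) = Fun0 c"
| "subst \<sigma> (Fun1 f t) = Fun1 f (subst \<sigma> t)"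
| "subst \<sigma> (Fun2 f s t) = Fun2 f (subst \<sigma> s) (subst \<sigma> t)"

inductive rstep :: "trs \<Rightarrow> trm \<Rightarrow> trm \<Rightarrow> bool" for R :: trs where
  root: "(l, r) \<in> R \<Longrightarrow> rstep R (subst \<sigma> l) (subst \<sigma> r)"
| un: "rstep R s t \<Longrightarrow> rstep R (Fun1 f s) (Fun1 f t)"
| bin_left: "rstep R s t \<Longrightarrow> rstep R (Fun2 f s u) (Fun2 f t u)"
| bin_right: "rstep R s t \<Longrightarrow> rstep R (Fun2 f u s) (Fun2 f u t)"

definition AC_axioms :: trs where
  "AC_axioms =
    {((Var ''x'' \<parallel> Var ''y'') \<parallel> Var ''z'', Var ''x'' \<parallel> (Var ''y'' \<parallel> Var ''z'')),
     (Var ''x'' \<parallel> Var ''y'', Var ''y'' \<parallel> Var ''x'')}"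

text \<open>The equivalence closure of a relation closed under contexts is again closed under contexts,
  so the following is the congruence generated by the two axioms.\<close>

definition eq_AC :: "trm \<Rightarrow> trm \<Rightarrow> bool"  (infix "=\<^sub>A\<^sub>C" 50) where
  "eq_AC = equivclp (rstep AC_axioms)"

definition rstep_AC :: "trs \<Rightarrow> trm \<Rightarrow> trm \<Rightarrow> bool" where
  "rstep_AC R = eq_AC OO rstep R OO eq_AC"

definition TRS_H :: trs where
  "TRS_H = (let n = Var ''n''; x = Var ''x''; y = Var ''y'' in
    {(tA n (tI tH), tA (tS n) tH),
     (tA n (tI (tH \<parallel> x)), tA (tS n) (tI x)),
     (tA n (tI x), tB n (tD (tS n) (tI x))),
     (tC tZ x, tE x),
     (tC (tS n) x, x \<parallel> tC n x),
     (tI (tE x \<parallel> y), tE (tI (x \<parallel> y))),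
     (tI (tE x), tE (tI x)),
     (tD n (tI (tI x)), tI (tD n (tI x))),
     (tD n (tI (tI x \<parallel> y)), tI (tD n (tI x) \<parallel> y)),
     (tD n (tI (tI (tH \<parallel> x) \<parallel> y)), tI (tC n (tI x) \<parallel> y)),
     (tD n (tI (tI (tH \<parallel> x))), tI (tC n (tI x))),
     (tD n (tI (tI tH \<parallel> y)), tI (tC n tH \<parallel> y)),
     (tD n (tI (tI tH)), tI (tC n tH)),
     (tB n (tE x), tA (tS n) x)})"

definition numeral_trm :: "nat \<Rightarrow> trm" where
  "numeral_trm n = (tS ^^ n) tZ"

inductive_set T_H :: "trm set" where
  h: "tH \<in> T_H"
| I: "t \<in> T_H \<Longrightarrow> tI t \<in> T_H"
| bar: "s \<in> T_H \<Longrightarrow> t \<in> T_H \<Longrightarrow> s \<parallel> t \<in> T_H"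

section \<open>Hydras, their encodings and battles\<close>

text \<open>A finite rooted unordered tree is given by the multiset of the subtrees at the children of
  its root; equality on this type is isomorphism of such trees.\<close>

datatype hydra = Node "hydra multiset"

abbreviation leaf :: hydra where "leaf \<equiv> Node {#}"

text \<open>\<open>encodes_forest M t\<close> means that \<open>t\<close> is \<open>t\<^sub>1 \<parallel> \<dots> \<parallel> t\<^sub>k\<close> (\<open>k \<ge> 1\<close>), bracketed and ordered in
  an arbitrary way, where the \<open>t\<^sub>i\<close> encode the \<open>k\<close> elements of the multiset \<open>M\<close>.\<close>

inductive encodes :: "hydra \<Rightarrow> trm \<Rightarrow> bool"
  and encodes_forest :: "hydra multiset \<Rightarrow> trm \<Rightarrow> bool" where
  leaf: "encodes leaf tH"
| node: "encodes_forest M t \<Longrightarrow> encodes (Node M) (tI t)"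
| single: "encodes T t \<Longrightarrow> encodes_forest {#T#} t"
| bar: "encodes_forest M s \<Longrightarrow> encodes_forest N t \<Longrightarrow> encodes_forest (M + N) (s \<parallel> t)"

text \<open>Hence one may speak of the Hydra encoded by a term.\<close>

lemma encodes_unique: "encodes T t \<Longrightarrow> encodes T' t \<Longrightarrow> T = T'"
  and encodes_forest_unique: "encodes_forest M t \<Longrightarrow> encodes_forest M' t \<Longrightarrow> M = M'"
proof (induction arbitrary: T' and M' rule: encodes_encodes_forest.inducts)
  case leaf
  then show ?case by cases simp
next
  case (node M t)
  from node.prems show ?case by cases (simp add: node.IH)
next
  case (single T t)
  from single.prems show ?case
  proof cases
    case (single U)
    then show ?thesis using single.IH by simp
  next
    case (bar M s N u)
    then show ?thesis using single.hyps by (auto elim: encodes.cases)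
  qed
next
  case (bar M s N t)
  from bar.prems show ?case
  proof cases
    case (single U)
    from single(2) show ?thesis by cases
  next
    case (bar M'' N'')
    then show ?thesis using bar.IH by simp
  qed
qed

text \<open>Cutting a head whose parent \<open>p\<close> is not the root. In \<open>grandparent\<close>, the root of the tree is
  the parent \<open>g\<close> of \<open>p\<close>, the subtree at \<open>p\<close> is \<open>Node (add_mset leaf P)\<close>, and it becomes \<open>Node P\<close>
  when the head is deleted; \<open>below\<close> covers the case that \<open>g\<close> is further away from the root.\<close>

inductive deep_cut :: "nat \<Rightarrow> hydra \<Rightarrow> hydra \<Rightarrow> bool" for n :: nat where
  grandparent: "deep_cut n
    (Node (add_mset (Node (add_mset leaf P)) M)) (Node (replicate_mset (n + 2) (Node P) + M))"
| below: "deep_cut n S S' \<Longrightarrow> deep_cut n (Node (add_mset S M)) (Node (add_mset S' M))"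

inductive battle_step :: "nat \<Rightarrow> hydra \<Rightarrow> hydra \<Rightarrow> bool" for n :: nat where
  at_root: "battle_step n (Node (add_mset leaf M)) (Node M)"
| deep: "deep_cut n T T' \<Longrightarrow> battle_step n T T'"

end

theory Submission
  imports Defs
begin

text \<open>The proof is semantic. Terms are interpreted in a monotone model in which the AC axioms are
  equalities and every rule of the system can only shrink the interpretation. Numerals and terms
  over \<open>h\<close>, \<open>I\<close>, \<open>\<parallel>\<close> have exact values, which rewriting never changes. A term with one
  occurrence of \<open>E\<close>, \<open>C\<close> or \<open>D\<close> above such values denotes the set of forests it may still become once
  its marker \<open>E\<close> has reached the top; \<open>D\<close> denotes all cuts below the root. Finally, for the stage
  \<open>n\<close> of the battle, an \<open>A\<close>- or \<open>B\<close>-term denotes the set of Hydras it may show at stage \<open>n + 1\<close>.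
  The claim follows by comparing the interpretations of both ends of the rewrite sequence.\<close>

fun num_val :: "trm \<Rightarrow> nat option" where
  "num_val (Fun0 Sym_0) = Some 0"
| "num_val (Fun1 Sym_s t) = map_option Suc (num_val t)"
| "num_val _ = None"

text \<open>A single Hydra counts as a one-element forest, so that \<open>\<parallel>\<close> can be
  read as multiset sum, which is associative and commutative.\<close>

fun forest_val :: "trm \<Rightarrow> hydra multiset option" where
  "forest_val (Fun0 Sym_h) = Some {#leaf#}"
| "forest_val (Fun1 Sym_I t) = map_option (\<lambda>M. {#Node M#}) (forest_val t)"
| "forest_val (Fun2 Sym_bar s t) =
    Option.bind (forest_val s) (\<lambda>M. map_option (\<lambda>N. M + N) (forest_val t))"
| "forest_val _ = None"

text \<open>A counter value \<open>Suc k\<close> at \<open>D\<close> leads to \<open>k + 2\<close> copies, which is what \<open>deep_cut k\<close> makes. The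
  value \<open>0\<close> never arises at \<open>D\<close> in a battle, and there the whole universe is a sound bound.\<close>

fun marked_vals :: "trm \<Rightarrow> hydra multiset set" where
  "marked_vals (Fun1 Sym_I t) = (\<lambda>M. {#Node M#}) ` marked_vals t"
| "marked_vals (Fun1 Sym_E t) = set_option (forest_val t)"
| "marked_vals (Fun2 Sym_bar s t) =
    {M + N | M N. M \<in> marked_vals s \<and> forest_val t = Some N} \<union>
    {M + N | M N. forest_val s = Some M \<and> N \<in> marked_vals t}"
| "marked_vals (Fun2 Sym_C s t) =
    {repeat_mset (Suc k) M | k M. num_val s = Some k \<and> forest_val t = Some M}"
| "marked_vals (Fun2 Sym_D s t) =
    (case num_val s of
       None \<Rightarrow> {}
     | Some 0 \<Rightarrow> UNIV
     | Some (Suc k) \<Rightarrow> {{#T'#} | T T'. forest_val t = Some {#T#} \<and> deep_cut k T T'})"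
| "marked_vals _ = {}"

text \<open>Before stage \<open>n\<close> anything is allowed, after stage \<open>n + 1\<close> nothing: stages never decrease.\<close>

fun next_hydras :: "nat \<Rightarrow> trm \<Rightarrow> hydra set" where
  "next_hydras n (Fun2 Sym_A s t) =
    (case num_val s of
       None \<Rightarrow> {}
     | Some m \<Rightarrow>
         if m < n then UNIV
         else if m = n then {T'. \<exists>T. forest_val t = Some {#T#} \<and> battle_step n T T'}
         else if m = Suc n then {T. forest_val t = Some {#T#}}
         else {})"
| "next_hydras n (Fun2 Sym_B s t) =
    (case num_val s of
       None \<Rightarrow> {}
     | Some m \<Rightarrow> if m < n then UNIV else if m = n then {T. {#T#} \<in> marked_vals t} else {})"
| "next_hydras n _ = {}"

definition sem_ge :: "nat \<Rightarrow> trm \<Rightarrow> trm \<Rightarrow> bool" where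
  "sem_ge n s t \<longleftrightarrow> num_val s = num_val t \<and> forest_val s = forest_val t \<and>
     marked_vals t \<subseteq> marked_vals s \<and> next_hydras n t \<subseteq> next_hydras n s"

lemma sem_ge_refl: "sem_ge n s s"
  by (simp add: sem_ge_def)

lemma sem_ge_trans: "sem_ge n s t \<Longrightarrow> sem_ge n t u \<Longrightarrow> sem_ge n s u"
  by (auto simp: sem_ge_def)

lemma sem_ge_Fun1:
  assumes "sem_ge n s t"
  shows "sem_ge n (Fun1 f s) (Fun1 f t)"
  using assms by (cases f) (auto simp: sem_ge_def)

lemma sem_ge_Fun2:
  assumes "sem_ge n s t" "sem_ge n s' t'"
  shows "sem_ge n (Fun2 f s s') (Fun2 f t t')"
  using assms by (cases f) (fastforce simp: sem_ge_def split: option.splits nat.splits)+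

text \<open>Closure under contexts reduces a step to rule instances. \<open>R\<close> is kept
  general to cover the AC axioms, their converse and \<open>TRS_H\<close>.\<close>

lemma rstep_sem_ge:
  assumes "rstep R s t"
    and "\<And>l r \<sigma>. (l, r) \<in> R \<Longrightarrow> sem_ge n (subst \<sigma> l) (subst \<sigma> r)"
  shows "sem_ge n s t"
  using assms by (induction rule: rstep.induct) (auto intro: sem_ge_Fun1 sem_ge_Fun2 sem_ge_refl)

lemma rstep_converse: "rstep R s t \<Longrightarrow> rstep (R\<inverse>) t s"
  by (induction rule: rstep.induct) (auto intro: rstep.intros)

lemma sem_ge_bar_assoc:
  "sem_ge n ((s \<parallel> t) \<parallel> u) (s \<parallel> (t \<parallel> u))" "sem_ge n (s \<parallel> (t \<parallel> u)) ((s \<parallel> t) \<parallel> u)"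
  by (cases "forest_val s"; cases "forest_val t"; cases "forest_val u";
      fastforce simp: sem_ge_def add.assoc)+

lemma sem_ge_bar_commute: "sem_ge n (s \<parallel> t) (t \<parallel> s)"
  by (cases "forest_val s"; cases "forest_val t"; fastforce simp: sem_ge_def add.commute)

lemma eq_AC_sem_ge:
  assumes "s =\<^sub>A\<^sub>C t"
  shows "sem_ge n s t"
proof -
  have fwd: "sem_ge n s t" if "rstep AC_axioms s t" for s t
    using that by (rule rstep_sem_ge)
      (auto simp: AC_axioms_def intro: sem_ge_bar_assoc sem_ge_bar_commute)
  have bwd: "sem_ge n t s" if "rstep AC_axioms s t" for s t
    using rstep_converse[OF that] by (rule rstep_sem_ge)
      (auto simp: AC_axioms_def intro: sem_ge_bar_assoc sem_ge_bar_commute)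
  show ?thesis
    using assms unfolding eq_AC_def
    by (induction rule: equivclp_induct) (auto intro: sem_ge_refl sem_ge_trans fwd bwd)
qed

text \<open>Here the copies have the shape that \<open>marked_vals\<close> gives to \<open>C\<close>
  at counter \<open>Suc k\<close>.\<close>

lemma deep_cut_copies:
  "deep_cut k (Node (add_mset (Node (add_mset leaf P)) M))
     (Node (repeat_mset (Suc (Suc k)) {#Node P#} + M))"
  using deep_cut.grandparent[of k P M] by (simp add: repeat_mset_replicate_mset)

lemma deep_cut_copies_single:
  "deep_cut k (Node {#Node (add_mset leaf P)#}) (Node (repeat_mset (Suc (Suc k)) {#Node P#}))"
  using deep_cut_copies[of k P "{#}"] by simp

lemma deep_cut_below_single: "deep_cut k S S' \<Longrightarrow> deep_cut k (Node {#S#}) (Node {#S'#})"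
  using deep_cut.below[of k S S' "{#}"] by simp

lemma TRS_H_sem_ge:
  assumes "(l, r) \<in> TRS_H"
  shows "sem_ge n (subst \<sigma> l) (subst \<sigma> r)"
proof -
  define k x y where "k = \<sigma> ''n''" and "x = \<sigma> ''x''" and "y = \<sigma> ''y''"
  have 1: "sem_ge n (tA k (tI tH)) (tA (tS k) tH)"
    using battle_step.at_root[of n "{#}"] by (auto simp: sem_ge_def split: option.splits)
  have 2: "sem_ge n (tA k (tI (tH \<parallel> x))) (tA (tS k) (tI x))"
    by (auto simp: sem_ge_def intro: battle_step.at_root split: option.splits)
  \<comment> \<open>If \<open>k\<close> has value \<open>n\<close>, then \<open>tS k\<close> has
    value \<open>Suc n\<close>, so \<open>D\<close> denotes the results of
    \<open>deep_cut n\<close>.\<close>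
  have 3: "sem_ge n (tA k (tI x)) (tB k (tD (tS k) (tI x)))"
    by (auto simp: sem_ge_def intro: battle_step.deep split: option.splits)
  have 4: "sem_ge n (tC tZ x) (tE x)"
    by (auto simp: sem_ge_def)
  have 5: "sem_ge n (tC (tS k) x) (x \<parallel> tC k x)"
    by (fastforce simp: sem_ge_def)
  have 6: "sem_ge n (tI (tE x \<parallel> y)) (tE (tI (x \<parallel> y)))"
    by (cases "forest_val x"; cases "forest_val y"; auto simp: sem_ge_def)
  have 7: "sem_ge n (tI (tE x)) (tE (tI x))"
    by (cases "forest_val x"; auto simp: sem_ge_def)
  have 8: "sem_ge n (tD k (tI (tI x))) (tI (tD k (tI x)))"
    by (fastforce simp: sem_ge_def intro: deep_cut_below_single split: option.splits nat.splits)
  have 9: "sem_ge n (tD k (tI (tI x \<parallel> y))) (tI (tD k (tI x) \<parallel> y))"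
    by (fastforce simp: sem_ge_def intro: deep_cut.below split: option.splits nat.splits)
  have 10: "sem_ge n (tD k (tI (tI (tH \<parallel> x) \<parallel> y))) (tI (tC k (tI x) \<parallel> y))"
    using deep_cut_copies by (fastforce simp: sem_ge_def split: option.splits nat.splits)
  have 11: "sem_ge n (tD k (tI (tI (tH \<parallel> x)))) (tI (tC k (tI x)))"
    using deep_cut_copies_single by (fastforce simp: sem_ge_def split: option.splits nat.splits)
  \<comment> \<open>The choice \<open>P = {#}\<close>: a parent that loses its only head becomes a
    leaf, so \<open>tH\<close> itself is copied.\<close>
  have 12: "sem_ge n (tD k (tI (tI tH \<parallel> y))) (tI (tC k tH \<parallel> y))"
    using deep_cut_copies[of _ "{#}"] by (fastforce simp: sem_ge_def split: option.splits nat.splits)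
  have 13: "sem_ge n (tD k (tI (tI tH))) (tI (tC k tH))"
    using deep_cut_copies_single[of _ "{#}"]
    by (fastforce simp: sem_ge_def split: option.splits nat.splits)
  have 14: "sem_ge n (tB k (tE x)) (tA (tS k) x)"
    by (auto simp: sem_ge_def split: option.splits)
  show ?thesis
    using assms 1 2 3 4 5 6 7 8 9 10 11 12 13 14
    unfolding TRS_H_def Let_def k_def x_def y_def by auto
qed

lemma rstep_AC_TRS_H_sem_ge: "rstep_AC TRS_H s t \<Longrightarrow> sem_ge n s t"
  unfolding rstep_AC_def
  by (blast intro: sem_ge_trans eq_AC_sem_ge rstep_sem_ge TRS_H_sem_ge)

lemma rewrites_sem_ge: "(rstep_AC TRS_H)\<^sup>*\<^sup>* s t \<Longrightarrow> sem_ge n s t"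
  by (induction rule: rtranclp_induct)
    (auto intro: sem_ge_refl sem_ge_trans rstep_AC_TRS_H_sem_ge)

lemma num_val_numeral_trm: "num_val (numeral_trm n) = Some n"
  by (induction n) (simp_all add: numeral_trm_def)

lemma encodes_forest_val: "encodes T t \<Longrightarrow> forest_val t = Some {#T#}"
  and encodes_forest_forest_val: "encodes_forest M t \<Longrightarrow> forest_val t = Some M"
  by (induction rule: encodes_encodes_forest.inducts) simp_all

theorem theorem3p11:
  fixes H H' :: trm and T T' :: hydra and n :: nat
  assumes "H \<in> T_H" and "H' \<in> T_H"
    and "encodes T H" and "encodes T' H'"
    and "(rstep_AC TRS_H)\<^sup>*\<^sup>* (tA (numeral_trm n) H) (tA (numeral_trm (Suc n)) H')"
  shows "battle_step n T T'"
proof -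
  have "T' \<in> next_hydras n (tA (numeral_trm (Suc n)) H')"
    using assms(4) by (simp add: num_val_numeral_trm encodes_forest_val)
  \<comment> \<open>Inclusion runs against rewriting: \<open>T'\<close> is carried back to stage
    \<open>n\<close>, where the set consists of the battle successors of \<open>T\<close>.\<close>
  then have "T' \<in> next_hydras n (tA (numeral_trm n) H)"
    using rewrites_sem_ge[OF assms(5), of n] by (auto simp: sem_ge_def)
  then show ?thesis
    using assms(3) by (simp add: num_val_numeral_trm encodes_forest_val)
qed

end
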